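(* Let $A$ be a unital C*-algebra, $\mathcal{M}$ a right C* $A$-$A$ correspondence, and let $\xi\in\mathcal{M}$ be such that $\mathcal{M}_\xi:=\overline{A\rhd\xi\lhd A}\in\mathsf{Bim_{fgp}}(A)$. Then $$\xi\in\big\{\eta\in\mathcal{M}_\xi\ \big|\ A\rhd\eta\lhd A=\mathcal{M}_\xi\big\}\subseteq\mathcal{M}_\xi,$$ and this set is open in $\mathcal{M}_\xi$. In particular, $\xi$ generates $\mathcal{M}_\xi$ algebraically.
   Context: A right C* $A$-$A$ correspondence is a right Hilbert $A$-module with a unital left action of $A$ by adjointable operators; left and right actions are written $\rhd$ and $\lhd$. For a vector $\eta$, $A\rhd\eta\lhd A:=\{\sum_{i\in I_0}a_i\rhd\eta\lhd a_i'\mid a_i,a_i'\in A,\ I_0\text{ finite}\}$ is the algebraic $A$-$A$ span of $\eta$, and $\overline{A\rhd\eta\lhd A}$ is its norm closure. A vector $\eta$ algebraically generates a bimodule $K$ if $A\rhd\eta\lhd A=K$. $\mathsf{Bim_{fgp}}(A)$ denotes the finitely generated projective $A$-$A$ bimodules, i.e. dualizable correspondences: $A$-$A$ correspondences also carrying a compatible left $A$-valued inner product (with equivalent norm), with finite left and right Pimsner–Popa bases (a right Pimsner–Popa basis of $K$ is a finite set $\{u_i\}\subset K$ with $\zeta=\sum_i u_i\lhd\langle u_i\mid\zeta\rangle_A$ for all $\zeta\in K$; left bases are analogous). *)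

theory Defs
  imports "HOL-Analysis.Analysis"
begin

text \<open>Complex normed spaces and unital C*-algebras are type classes. Since
  \<^class>\<open>monoid_mult\<close> does not demand \<open>1 \<noteq> 0\<close>, the zero algebra is admitted; the
  norm of \<open>1\<close> is otherwise forced by the C*-identity.\<close>

class scaleC =
  fixes scaleC :: "complex \<Rightarrow> 'a \<Rightarrow> 'a"  (infixr "*\<^sub>C" 75)

class complex_normed_vector = real_normed_vector + scaleC +
  assumes scaleC_add_right: "c *\<^sub>C (x + y) = c *\<^sub>C x + c *\<^sub>C y"
    and scaleC_add_left: "(c + d) *\<^sub>C x = c *\<^sub>C x + d *\<^sub>C x"
    and scaleC_scaleC: "c *\<^sub>C d *\<^sub>C x = (c * d) *\<^sub>C x"
    and scaleC_of_real: "complex_of_real r *\<^sub>C x = r *\<^sub>R x"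
    and norm_scaleC: "norm (c *\<^sub>C x) = cmod c * norm x"

class unital_cstar_algebra =
  complex_normed_vector + real_normed_algebra + monoid_mult + banach +
  fixes adj :: "'a \<Rightarrow> 'a"
  assumes mult_scaleC_left: "(c *\<^sub>C a) * b = c *\<^sub>C (a * b)"
    and mult_scaleC_right: "a * (c *\<^sub>C b) = c *\<^sub>C (a * b)"
    and adj_adj: "adj (adj a) = a"
    and adj_add: "adj (a + b) = adj a + adj b"
    and adj_scaleC: "adj (c *\<^sub>C a) = cnj c *\<^sub>C adj a"
    and adj_mult: "adj (a * b) = adj b * adj a"
    and cstar_identity: "norm (adj a * a) = (norm a)\<^sup>2"

definition cstar_positive :: "'a::unital_cstar_algebra \<Rightarrow> bool" where
  "cstar_positive a \<longleftrightarrow> (\<exists>b. a = adj b * b)"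

text \<open>Modules live on carrier sets \<open>K\<close> of a complex normed space, so that a closed
  sub-bimodule of a correspondence is again a structure of the same kind. The norm of
  the ambient space is required to be the Hilbert module norm on \<open>K\<close>, which in
  particular makes the inner product definite.\<close>

locale right_hilbert_module =
  fixes K :: "'m::complex_normed_vector set"
    and ract :: "'m \<Rightarrow> 'a::unital_cstar_algebra \<Rightarrow> 'm"  (infixl "\<lhd>" 75)
    and rinner :: "'m \<Rightarrow> 'm \<Rightarrow> 'a"
  assumes zero_closed: "0 \<in> K"
    and add_closed: "x \<in> K \<Longrightarrow> y \<in> K \<Longrightarrow> x + y \<in> K"
    and scaleC_closed: "x \<in> K \<Longrightarrow> c *\<^sub>C x \<in> K"
    and ract_closed: "x \<in> K \<Longrightarrow> x \<lhd> a \<in> K"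
    and ract_add_left: "x \<in> K \<Longrightarrow> y \<in> K \<Longrightarrow> (x + y) \<lhd> a = x \<lhd> a + y \<lhd> a"
    and ract_add_right: "x \<in> K \<Longrightarrow> x \<lhd> (a + b) = x \<lhd> a + x \<lhd> b"
    and ract_scaleC_left: "x \<in> K \<Longrightarrow> (c *\<^sub>C x) \<lhd> a = c *\<^sub>C (x \<lhd> a)"
    and ract_scaleC_right: "x \<in> K \<Longrightarrow> x \<lhd> (c *\<^sub>C a) = c *\<^sub>C (x \<lhd> a)"
    and ract_mult: "x \<in> K \<Longrightarrow> x \<lhd> (a * b) = (x \<lhd> a) \<lhd> b"
    and ract_one: "x \<in> K \<Longrightarrow> x \<lhd> 1 = x"
    and rinner_add_right:
      "x \<in> K \<Longrightarrow> y \<in> K \<Longrightarrow> z \<in> K \<Longrightarrow> rinner x (y + z) = rinner x y + rinner x z"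
    and rinner_scaleC_right:
      "x \<in> K \<Longrightarrow> y \<in> K \<Longrightarrow> rinner x (c *\<^sub>C y) = c *\<^sub>C rinner x y"
    and rinner_ract_right:
      "x \<in> K \<Longrightarrow> y \<in> K \<Longrightarrow> rinner x (y \<lhd> a) = rinner x y * a"
    and rinner_adj: "x \<in> K \<Longrightarrow> y \<in> K \<Longrightarrow> adj (rinner x y) = rinner y x"
    and rinner_positive: "x \<in> K \<Longrightarrow> cstar_positive (rinner x x)"
    and norm_eq: "x \<in> K \<Longrightarrow> norm x = sqrt (norm (rinner x x))"
    and complete: "complete K"

text \<open>The left action is a unital *-homomorphism into the adjointable operators: the
  adjoint of \<open>a \<rhd> _\<close> is \<open>adj a \<rhd> _\<close>.\<close>

locale right_correspondence = right_hilbert_module K ract rinner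
  for K :: "'m::complex_normed_vector set"
    and lact :: "'a::unital_cstar_algebra \<Rightarrow> 'm \<Rightarrow> 'm"  (infixr "\<rhd>" 75)
    and ract :: "'m \<Rightarrow> 'a \<Rightarrow> 'm"  (infixl "\<lhd>" 75)
    and rinner :: "'m \<Rightarrow> 'm \<Rightarrow> 'a" +
  assumes lact_closed: "x \<in> K \<Longrightarrow> a \<rhd> x \<in> K"
    and lact_add_right: "x \<in> K \<Longrightarrow> y \<in> K \<Longrightarrow> a \<rhd> (x + y) = (a \<rhd> x) + (a \<rhd> y)"
    and lact_add_left: "x \<in> K \<Longrightarrow> (a + b) \<rhd> x = (a \<rhd> x) + (b \<rhd> x)"
    and lact_scaleC_right: "x \<in> K \<Longrightarrow> a \<rhd> (c *\<^sub>C x) = c *\<^sub>C (a \<rhd> x)"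
    and lact_scaleC_left: "x \<in> K \<Longrightarrow> (c *\<^sub>C a) \<rhd> x = c *\<^sub>C (a \<rhd> x)"
    and lact_mult: "x \<in> K \<Longrightarrow> (a * b) \<rhd> x = a \<rhd> (b \<rhd> x)"
    and lact_one: "x \<in> K \<Longrightarrow> 1 \<rhd> x = x"
    and lact_ract: "x \<in> K \<Longrightarrow> (a \<rhd> x) \<lhd> b = a \<rhd> (x \<lhd> b)"
    and lact_adjoint:
      "x \<in> K \<Longrightarrow> y \<in> K \<Longrightarrow> rinner (a \<rhd> x) y = rinner x (adj a \<rhd> y)"

text \<open>A left inner product is linear in its first argument. Compatibility means that the
  right action is by operators adjointable for it and that the two norms are equivalent,
  so that completeness for the left norm is automatic. The imprimitivity relation
  \<open>linner x y \<rhd> z = x \<lhd> rinner y z\<close> is not part of it.\<close>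

locale compatible_left_inner = right_correspondence K lact ract rinner
  for K :: "'m::complex_normed_vector set"
    and lact :: "'a::unital_cstar_algebra \<Rightarrow> 'm \<Rightarrow> 'm"  (infixr "\<rhd>" 75)
    and ract :: "'m \<Rightarrow> 'a \<Rightarrow> 'm"  (infixl "\<lhd>" 75)
    and rinner :: "'m \<Rightarrow> 'm \<Rightarrow> 'a" +
  fixes linner :: "'m \<Rightarrow> 'm \<Rightarrow> 'a"
  assumes linner_add_left:
      "x \<in> K \<Longrightarrow> y \<in> K \<Longrightarrow> z \<in> K \<Longrightarrow> linner (x + y) z = linner x z + linner y z"
    and linner_scaleC_left:
      "x \<in> K \<Longrightarrow> y \<in> K \<Longrightarrow> linner (c *\<^sub>C x) y = c *\<^sub>C linner x y"
    and linner_lact_left: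
      "x \<in> K \<Longrightarrow> y \<in> K \<Longrightarrow> linner (a \<rhd> x) y = a * linner x y"
    and linner_adj: "x \<in> K \<Longrightarrow> y \<in> K \<Longrightarrow> adj (linner x y) = linner y x"
    and linner_positive: "x \<in> K \<Longrightarrow> cstar_positive (linner x x)"
    and ract_adjoint:
      "x \<in> K \<Longrightarrow> y \<in> K \<Longrightarrow> linner (x \<lhd> a) y = linner x (y \<lhd> adj a)"
    and equivalent_norm:
      "\<exists>c>0. \<exists>C>0. \<forall>x\<in>K. c * norm x \<le> sqrt (norm (linner x x)) \<and>
                          sqrt (norm (linner x x)) \<le> C * norm x"

definition right_pimsner_popa_basis ::
  "'m::complex_normed_vector set \<Rightarrow> ('m \<Rightarrow> 'a \<Rightarrow> 'm) \<Rightarrow> ('m \<Rightarrow> 'm \<Rightarrow> 'a) \<Rightarrow> 'm set \<Rightarrow> bool" where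
  "right_pimsner_popa_basis K ract rinner U \<longleftrightarrow>
     finite U \<and> U \<subseteq> K \<and> (\<forall>z\<in>K. z = (\<Sum>u\<in>U. ract u (rinner u z)))"

definition left_pimsner_popa_basis ::
  "'m::complex_normed_vector set \<Rightarrow> ('a \<Rightarrow> 'm \<Rightarrow> 'm) \<Rightarrow> ('m \<Rightarrow> 'm \<Rightarrow> 'a) \<Rightarrow> 'm set \<Rightarrow> bool" where
  "left_pimsner_popa_basis K lact linner V \<longleftrightarrow>
     finite V \<and> V \<subseteq> K \<and> (\<forall>z\<in>K. z = (\<Sum>v\<in>V. lact (linner z v) v))"

text \<open>Membership in \<open>Bim\<^sub>f\<^sub>g\<^sub>p(A)\<close> of the correspondence with carrier \<open>K\<close>.\<close>

definition Bim_fgp ::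
  "'m::complex_normed_vector set \<Rightarrow> ('a::unital_cstar_algebra \<Rightarrow> 'm \<Rightarrow> 'm) \<Rightarrow>
   ('m \<Rightarrow> 'a \<Rightarrow> 'm) \<Rightarrow> ('m \<Rightarrow> 'm \<Rightarrow> 'a) \<Rightarrow> bool" where
  "Bim_fgp K lact ract rinner \<longleftrightarrow>
     right_correspondence K lact ract rinner \<and>
     (\<exists>linner. compatible_left_inner K lact ract rinner linner \<and>
        (\<exists>V. left_pimsner_popa_basis K lact linner V)) \<and>
     (\<exists>U. right_pimsner_popa_basis K ract rinner U)"

definition AA_span ::
  "('a::unital_cstar_algebra \<Rightarrow> 'm \<Rightarrow> 'm) \<Rightarrow> ('m \<Rightarrow> 'a \<Rightarrow> 'm) \<Rightarrow> 'm::complex_normed_vector \<Rightarrow> 'm set" where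
  "AA_span lact ract \<eta> =
     {\<Sum>i\<in>I. ract (lact (a i) \<eta>) (a' i) | (I :: nat set) a a'. finite I}"

definition algebraically_generates ::
  "('a::unital_cstar_algebra \<Rightarrow> 'm \<Rightarrow> 'm) \<Rightarrow> ('m \<Rightarrow> 'a \<Rightarrow> 'm) \<Rightarrow>
   'm::complex_normed_vector \<Rightarrow> 'm set \<Rightarrow> bool" where
  "algebraically_generates lact ract \<eta> K \<longleftrightarrow> AA_span lact ract \<eta> = K"

text \<open>A correspondence \<open>M\<close> is complete, hence closed in the ambient space, so for
  \<open>\<xi> \<in> M\<close> the ambient closure below is the closure taken in \<open>M\<close>.\<close>

definition generated_sub ::
  "('a::unital_cstar_algebra \<Rightarrow> 'm \<Rightarrow> 'm) \<Rightarrow> ('m \<Rightarrow> 'a \<Rightarrow> 'm) \<Rightarrow> 'm::complex_normed_vector \<Rightarrow> 'm set" where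
  "generated_sub lact ract \<xi> = closure (AA_span lact ract \<xi>)"

end

theory Submission
  imports Defs
begin

text \<open>The argument perturbs a right Pimsner--Popa basis \<open>U\<close> of \<open>M\<^sub>\<xi>\<close>. Replacing each \<open>u \<in> U\<close> by a nearby
  \<open>f u\<close> changes the identity \<open>z = (\<Sum>u\<in>U. u \<lhd> rinner u z)\<close> into an operator
  \<open>T z = (\<Sum>u\<in>U. f u \<lhd> rinner u z)\<close> with \<open>norm (z - T z) \<le> c * norm z\<close> for some \<open>c < 1\<close>, and such an
  operator is onto because the module is complete. If the \<open>f u\<close> lie in a right submodule \<open>N\<close>, so
  does the range of \<open>T\<close>; hence a right submodule that comes close enough to every basis vector
  is the whole module (\<open>right_submodule_near_basis\<close>). Closeness is measured by a single
  \<open>\<delta>\<close> that does not depend on \<open>N\<close>, and both halves of the theorem follow from this.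

  Generation: \<open>A \<rhd> \<xi> \<lhd> A\<close> is a right submodule that is dense in \<open>M\<^sub>\<xi>\<close>, so it comes arbitrarily close
  to every basis vector and is equal to \<open>M\<^sub>\<xi>\<close>.

  Openness: if \<open>\<eta>\<close> generates, every basis vector is a finite sum of terms \<open>a \<rhd> \<eta> \<lhd> a'\<close>. With the
  coefficients fixed, this sum depends continuously on \<open>\<eta>\<close>, so for \<open>\<zeta>\<close> near \<open>\<eta>\<close> the
  submodule \<open>A \<rhd> \<zeta> \<lhd> A\<close> still comes within \<open>\<delta>\<close> of every basis vector.

  Only the existence of bounds matters in these estimates, not their size. A Cauchy--Schwarz
  inequality with constant 4 comes from polarization (\<open>norm_rinner_le\<close>), and boundedness of the
  left action comes from the finite basis (\<open>lact_bounded\<close>).\<close>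

section \<open>Estimates in Hilbert modules\<close>

lemma norm_adj: "norm (adj a) = norm (a::'a::unital_cstar_algebra)"
proof -
  have le: "norm b \<le> norm (adj b)" for b :: 'a
  proof (cases "b = 0")
    case False
    have "norm b * norm b \<le> norm (adj b) * norm b"
      using cstar_identity[of b] norm_mult_ineq[of "adj b" b] by (simp add: power2_eq_square)
    then show ?thesis using False by simp
  qed simp
  show ?thesis using le[of a] le[of "adj a"] by (simp add: adj_adj)
qed

lemma scaleC_minus_one: "(-1) *\<^sub>C x = - (x::'m::complex_normed_vector)"
  using scaleC_of_real[of "-1" x] by simp

context right_hilbert_module
begin

lemma minus_closed: "x \<in> K \<Longrightarrow> - x \<in> K"
  using scaleC_closed[of x "-1"] by (simp add: scaleC_minus_one)

lemma diff_closed: "x \<in> K \<Longrightarrow> y \<in> K \<Longrightarrow> x - y \<in> K"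
  using add_closed[of x "- y"] minus_closed[of y] by simp

lemma scaleR_closed: "x \<in> K \<Longrightarrow> r *\<^sub>R x \<in> K"
  using scaleC_closed[of x "complex_of_real r"] by (simp add: scaleC_of_real)

lemma sum_closed: "(\<And>i. i \<in> I \<Longrightarrow> f i \<in> K) \<Longrightarrow> sum f I \<in> K"
  by (induction I rule: infinite_finite_induct) (auto simp: zero_closed add_closed)

lemma ract_diff_left: "x \<in> K \<Longrightarrow> y \<in> K \<Longrightarrow> (x - y) \<lhd> a = x \<lhd> a - y \<lhd> a"
  using ract_add_left[of "x - y" y a] diff_closed[of x y] by (simp add: algebra_simps)

lemma ract_diff_right: "x \<in> K \<Longrightarrow> x \<lhd> (a - b) = x \<lhd> a - x \<lhd> b"
  using ract_add_right[of x "a - b" b] by (simp add: algebra_simps)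

lemma ract_zero_left: "0 \<lhd> a = 0"
  using ract_add_left[OF zero_closed zero_closed, of a] by simp

lemma ract_sum_left:
  "(\<And>i. i \<in> I \<Longrightarrow> f i \<in> K) \<Longrightarrow> (\<Sum>i\<in>I. f i) \<lhd> a = (\<Sum>i\<in>I. f i \<lhd> a)"
  by (induction I rule: infinite_finite_induct)
    (auto simp: ract_zero_left ract_add_left sum_closed)

lemma rinner_diff_right:
  "x \<in> K \<Longrightarrow> y \<in> K \<Longrightarrow> z \<in> K \<Longrightarrow> rinner x (y - z) = rinner x y - rinner x z"
  using rinner_add_right[of x "y - z" z] diff_closed[of y z] by (simp add: algebra_simps)

lemma rinner_add_left:
  assumes "x \<in> K" "y \<in> K" "z \<in> K"
  shows "rinner (x + y) z = rinner x z + rinner y z"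
  using rinner_adj[of z "x + y"] rinner_adj[of z x] rinner_adj[of z y] assms
  by (simp add: add_closed rinner_add_right adj_add)

lemma rinner_diff_left:
  "x \<in> K \<Longrightarrow> y \<in> K \<Longrightarrow> z \<in> K \<Longrightarrow> rinner (x - y) z = rinner x z - rinner y z"
  using rinner_add_left[of "x - y" y z] diff_closed[of x y] by (simp add: algebra_simps)

lemma rinner_scaleC_left:
  assumes "x \<in> K" "y \<in> K"
  shows "rinner (c *\<^sub>C x) y = cnj c *\<^sub>C rinner x y"
  using rinner_adj[of y "c *\<^sub>C x"] rinner_adj[of y x] assms
  by (simp add: scaleC_closed rinner_scaleC_right adj_scaleC)

lemma rinner_ract_left:
  assumes "x \<in> K" "y \<in> K"
  shows "rinner (x \<lhd> a) y = adj a * rinner x y"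
  using rinner_adj[of y "x \<lhd> a"] rinner_adj[of y x] assms
  by (simp add: ract_closed rinner_ract_right adj_mult)

lemma norm_rinner_self: "x \<in> K \<Longrightarrow> norm (rinner x x) = (norm x)\<^sup>2"
  by (simp add: norm_eq)

lemma norm_ract_le:
  assumes x: "x \<in> K"
  shows "norm (x \<lhd> a) \<le> norm x * norm a"
proof -
  have "(norm (x \<lhd> a))\<^sup>2 = norm (adj a * (rinner x x * a))"
    using x by (simp add: norm_rinner_self[symmetric] ract_closed rinner_ract_left rinner_ract_right
        mult.assoc)
  also have "\<dots> \<le> norm a * (norm (rinner x x) * norm a)"
    by (metis norm_adj norm_mult_ineq mult_left_mono norm_ge_zero order_trans)
  also have "\<dots> = (norm x * norm a)\<^sup>2"
    using x by (simp add: norm_rinner_self power2_eq_square)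
  finally show ?thesis by (rule power2_le_imp_le) simp
qed

lemma polarization:
  assumes x: "x \<in> K" and y: "y \<in> K"
  shows "4 *\<^sub>R rinner x y =
    (rinner (x + y) (x + y) - rinner (x - y) (x - y)) -
    \<i> *\<^sub>C (rinner (x + \<i> *\<^sub>C y) (x + \<i> *\<^sub>C y) - rinner (x - \<i> *\<^sub>C y) (x - \<i> *\<^sub>C y))"
proof -
  have cross: "rinner (x + z) (x + z) - rinner (x - z) (x - z) = 2 *\<^sub>R (rinner x z + rinner z x)"
    if z: "z \<in> K" for z
  proof -
    have "rinner (x + z) (x + z) = rinner x x + rinner x z + (rinner z x + rinner z z)"
      using x z by (simp add: rinner_add_left rinner_add_right add_closed algebra_simps)
    moreover have "rinner (x - z) (x - z) = rinner x x - rinner x z - (rinner z x - rinner z z)"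
      using x z by (simp add: rinner_diff_left rinner_diff_right diff_closed algebra_simps)
    ultimately show ?thesis by (simp add: algebra_simps scaleR_2)
  qed
  have i2: "\<i> *\<^sub>C \<i> *\<^sub>C a = - a" "\<i> *\<^sub>C (- \<i>) *\<^sub>C a = a" for a :: 'a
    using scaleC_of_real[of 1 a] by (simp_all add: scaleC_scaleC scaleC_minus_one)
  have "\<i> *\<^sub>C (2 *\<^sub>R (rinner x (\<i> *\<^sub>C y) + rinner (\<i> *\<^sub>C y) x)) = 2 *\<^sub>R (rinner y x - rinner x y)"
    using x y
    by (simp add: rinner_scaleC_right rinner_scaleC_left scaleR_2 scaleC_add_right i2 algebra_simps)
  moreover have "4 *\<^sub>R rinner x y =
      2 *\<^sub>R (rinner x y + rinner y x) - 2 *\<^sub>R (rinner y x - rinner x y)"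
    by (simp add: algebra_simps flip: scaleR_add_left)
  ultimately show ?thesis
    using cross[OF y] cross[OF scaleC_closed[OF y, of \<i>]] by simp
qed

text \<open>Polarization bounds the inner product of two unit vectors by values \<open>rinner z z\<close> with
  \<open>norm z \<le> 2\<close>, whose norms are at most 4; the general case follows by scaling.\<close>

lemma norm_rinner_le:
  assumes x: "x \<in> K" and y: "y \<in> K"
  shows "norm (rinner x y) \<le> 4 * norm x * norm y"
proof -
  have unit: "norm (rinner x y) \<le> 4"
    if x: "x \<in> K" and y: "y \<in> K" and n: "norm x = 1" "norm y = 1" for x y
  proof -
    have b: "norm (rinner z z) \<le> 4" if "z \<in> K" "norm z \<le> 2" for z
      using power_mono[OF that(2), of 2] that(1) by (simp add: norm_rinner_self)
    have iy: "\<i> *\<^sub>C y \<in> K" "norm (\<i> *\<^sub>C y) = 1"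
      using y n by (auto simp: scaleC_closed norm_scaleC)
    have pm: "norm (rinner (x + z) (x + z) - rinner (x - z) (x - z)) \<le> 8"
      if "z \<in> K" "norm z = 1" for z
    proof -
      have "norm (rinner (x + z) (x + z)) \<le> 4"
        using that x n norm_triangle_ineq[of x z] by (intro b) (auto simp: add_closed)
      moreover have "norm (rinner (x - z) (x - z)) \<le> 4"
        using that x n norm_triangle_ineq4[of x z] by (intro b) (auto simp: diff_closed)
      ultimately show ?thesis
        using norm_triangle_ineq4[of "rinner (x + z) (x + z)" "rinner (x - z) (x - z)"] by linarith
    qed
    have "norm (4 *\<^sub>R rinner x y) \<le> 8 + 8"
      unfolding polarization[OF x y]
      by (rule order_trans[OF norm_triangle_ineq4 add_mono])
        (use pm[OF y n(2)] pm[OF iy] in \<open>simp_all add: norm_scaleC\<close>)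
    then show ?thesis by simp
  qed
  show ?thesis
  proof (cases "x = 0 \<or> y = 0")
    case True
    then show ?thesis
      using rinner_diff_right[OF x y y] rinner_diff_right[OF y x x]
        rinner_adj[of y x] norm_adj[of "rinner y x"] x y by auto
  next
    case False
    define x' y' where "x' = inverse (norm x) *\<^sub>R x" and "y' = inverse (norm y) *\<^sub>R y"
    have u: "x' \<in> K" "y' \<in> K" "norm x' = 1" "norm y' = 1"
      using False x y by (auto simp: x'_def y'_def scaleR_closed)
    have xy: "x = complex_of_real (norm x) *\<^sub>C x'" "y = complex_of_real (norm y) *\<^sub>C y'"
      using False by (auto simp: x'_def y'_def scaleC_of_real)
    have "rinner (complex_of_real (norm x) *\<^sub>C x') (complex_of_real (norm y) *\<^sub>C y') =
        complex_of_real (norm x) *\<^sub>C complex_of_real (norm y) *\<^sub>C rinner x' y'"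
      by (simp add: u scaleC_closed rinner_scaleC_left rinner_scaleC_right scaleC_scaleC mult.commute)
    then have "rinner x y = complex_of_real (norm x) *\<^sub>C complex_of_real (norm y) *\<^sub>C rinner x' y'"
      by (simp only: xy[symmetric])
    then have "norm (rinner x y) = norm x * norm y * norm (rinner x' y')"
      by (simp add: norm_scaleC)
    also have "\<dots> \<le> norm x * norm y * 4"
      by (intro mult_left_mono unit u) simp
    finally show ?thesis by (simp add: mult_ac)
  qed
qed

section \<open>Right submodules close to a finite basis\<close>

definition right_submodule :: "'m set \<Rightarrow> bool" where
  "right_submodule N \<longleftrightarrow> N \<subseteq> K \<and> 0 \<in> N \<and>
     (\<forall>x\<in>N. \<forall>y\<in>N. x + y \<in> N) \<and> (\<forall>x\<in>N. \<forall>a. x \<lhd> a \<in> N)"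

lemma right_submodule_sum:
  "right_submodule N \<Longrightarrow> (\<And>i. i \<in> I \<Longrightarrow> f i \<in> N) \<Longrightarrow> sum f I \<in> N"
  by (induction I rule: infinite_finite_induct) (auto simp: right_submodule_def)

text \<open>Solving \<open>T z = w\<close> for the perturbed reconstruction operator \<open>T\<close> amounts to finding a fixed
  point of \<open>z \<mapsto> w + (z - T z)\<close>, which is a contraction of \<open>K\<close>. The bound \<open>\<delta>\<close> depends only on the
  norms of the basis vectors, so it serves all submodules simultaneously.\<close>

lemma right_submodule_near_basis:
  assumes U: "right_pimsner_popa_basis K ract rinner U"
  shows "\<exists>\<delta>>0. \<forall>N. right_submodule N \<longrightarrow> (\<forall>u\<in>U. \<exists>v\<in>N. norm (v - u) < \<delta>) \<longrightarrow> N = K"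
proof -
  define s where "s = (\<Sum>u\<in>U. 4 * norm u)"
  \<comment> \<open>The contraction constant will be \<open>\<delta> * s\<close>; the summand 1 makes it smaller than 1 and
    covers the case \<open>s = 0\<close>.\<close>
  define \<delta> where "\<delta> = 1 / (1 + s)"
  define c where "c = \<delta> * s"
  have s: "0 \<le> s" by (auto simp: s_def intro: sum_nonneg)
  have \<delta>: "\<delta> > 0" using s by (simp add: \<delta>_def)
  have c: "0 \<le> c" "c < 1" using s by (auto simp: c_def \<delta>_def field_simps)
  have UK: "\<And>u. u \<in> U \<Longrightarrow> u \<in> K"
    and basis: "\<And>z. z \<in> K \<Longrightarrow> (\<Sum>u\<in>U. u \<lhd> rinner u z) = z"
    using U by (auto simp: right_pimsner_popa_basis_def)
  have "N = K" if N: "right_submodule N" and near: "\<forall>u\<in>U. \<exists>v\<in>N. norm (v - u) < \<delta>" for N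
  proof
    show "N \<subseteq> K" using N by (simp add: right_submodule_def)
    obtain f where f: "\<And>u. u \<in> U \<Longrightarrow> f u \<in> N" "\<And>u. u \<in> U \<Longrightarrow> norm (f u - u) < \<delta>"
      using near by metis
    have fK: "\<And>u. u \<in> U \<Longrightarrow> f u \<in> K" using f N by (auto simp: right_submodule_def)
    define T where "T z = (\<Sum>u\<in>U. f u \<lhd> rinner u z)" for z
    have TN: "T z \<in> N" for z
      unfolding T_def using N f by (intro right_submodule_sum) (auto simp: right_submodule_def)
    then have TK: "T z \<in> K" for z using N by (auto simp: right_submodule_def)
    have T_diff: "T (x - y) = T x - T y" if "x \<in> K" "y \<in> K" for x y
      using that fK UK
      by (simp add: T_def rinner_diff_right ract_diff_right sum_subtractf)
    have T_near: "norm (z - T z) \<le> c * norm z" if z: "z \<in> K" for z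
    proof -
      have "z - T z = (\<Sum>u\<in>U. (u - f u) \<lhd> rinner u z)"
        by (subst (1) basis[OF z, symmetric])
          (simp add: T_def ract_diff_left UK fK flip: sum_subtractf)
      also have "norm \<dots> \<le> (\<Sum>u\<in>U. \<delta> * (4 * norm u * norm z))"
      proof (rule sum_norm_le)
        fix u assume u: "u \<in> U"
        have "norm ((u - f u) \<lhd> rinner u z) \<le> norm (u - f u) * norm (rinner u z)"
          using u by (intro norm_ract_le diff_closed UK fK)
        also have "\<dots> \<le> \<delta> * (4 * norm u * norm z)"
          using f(2)[OF u] norm_rinner_le[OF UK[OF u] z] \<delta>
          by (intro mult_mono) (auto simp: norm_minus_commute)
        finally show "norm ((u - f u) \<lhd> rinner u z) \<le> \<delta> * (4 * norm u * norm z)" .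
      qed
      also have "\<dots> = c * norm z"
        unfolding c_def s_def sum_distrib_left sum_distrib_right by (simp add: mult_ac)
      finally show ?thesis .
    qed
    show "K \<subseteq> N"
    proof
      fix w assume w: "w \<in> K"
      have "\<exists>!z\<in>K. w + (z - T z) = z"
      proof (rule Banach_fix[OF complete _ c])
        show "K \<noteq> {}" using zero_closed by auto
        show "(\<lambda>z. w + (z - T z)) ` K \<subseteq> K" using w TK by (auto intro: add_closed diff_closed)
        show "dist (w + (x - T x)) (w + (y - T y)) \<le> c * dist x y"
          if "x \<in> K" "y \<in> K" for x y
        proof -
          have "w + (x - T x) - (w + (y - T y)) = (x - y) - T (x - y)"
            using that by (simp add: T_diff)
          then show ?thesis
            using T_near[of "x - y"] that by (simp only: dist_norm diff_closed)
        qed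
      qed
      then obtain z where "w + (z - T z) = z" by blast
      then have "w = T z" by (simp add: algebra_simps)
      then show "w \<in> N" using TN by simp
    qed
  qed
  with \<delta> show ?thesis by blast
qed

end

section \<open>Generating vectors\<close>

context right_correspondence
begin

lemma lact_diff_right: "x \<in> K \<Longrightarrow> y \<in> K \<Longrightarrow> a \<rhd> (x - y) = a \<rhd> x - a \<rhd> y"
  using lact_add_right[of "x - y" y a] diff_closed[of x y] by (simp add: algebra_simps)

lemma lact_sum_right:
  "(\<And>i. i \<in> I \<Longrightarrow> f i \<in> K) \<Longrightarrow> a \<rhd> (\<Sum>i\<in>I. f i) = (\<Sum>i\<in>I. a \<rhd> f i)"
  using lact_diff_right[OF zero_closed zero_closed, of a]
  by (induction I rule: infinite_finite_induct) (auto simp: lact_add_right sum_closed)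

text \<open>An element \<open>a\<close> acts on \<open>z = (\<Sum>u\<in>U. u \<lhd> rinner u z)\<close> only through the finitely many vectors
  \<open>a \<rhd> u\<close>, since the left action commutes with the right one.
  Together with the bound on \<open>rinner u z\<close> this gives a constant that depends on \<open>a\<close> and \<open>U\<close>.\<close>

lemma lact_bounded:
  assumes U: "right_pimsner_popa_basis K ract rinner U"
  obtains C where "C \<ge> 0" and "\<And>z. z \<in> K \<Longrightarrow> norm (a \<rhd> z) \<le> C * norm z"
proof -
  define C where "C = (\<Sum>u\<in>U. norm (a \<rhd> u) * (4 * norm u))"
  have UK: "\<And>u. u \<in> U \<Longrightarrow> u \<in> K"
    and basis: "\<And>z. z \<in> K \<Longrightarrow> (\<Sum>u\<in>U. u \<lhd> rinner u z) = z"
    using U by (auto simp: right_pimsner_popa_basis_def)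
  have "norm (a \<rhd> z) \<le> C * norm z" if z: "z \<in> K" for z
  proof -
    have "a \<rhd> z = (\<Sum>u\<in>U. (a \<rhd> u) \<lhd> rinner u z)"
      by (subst (1) basis[OF z, symmetric]) (simp add: lact_sum_right lact_ract UK ract_closed)
    also have "norm \<dots> \<le> (\<Sum>u\<in>U. norm (a \<rhd> u) * (4 * norm u * norm z))"
    proof (rule sum_norm_le)
      fix u assume u: "u \<in> U"
      show "norm ((a \<rhd> u) \<lhd> rinner u z) \<le> norm (a \<rhd> u) * (4 * norm u * norm z)"
        using norm_ract_le[OF lact_closed[OF UK[OF u]], of a "rinner u z"]
          mult_left_mono[OF norm_rinner_le[OF UK[OF u] z], of "norm (a \<rhd> u)"]
        by simp
    qed
    also have "\<dots> = C * norm z"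
      unfolding C_def sum_distrib_right by (simp add: mult_ac)
    finally show ?thesis .
  qed
  moreover have "C \<ge> 0" by (auto simp: C_def intro!: sum_nonneg)
  ultimately show thesis using that by blast
qed

lemma sum_in_AA_span:
  assumes "finite I"
  shows "(\<Sum>i\<in>I. (a i \<rhd> \<eta>) \<lhd> b i) \<in> AA_span lact ract \<eta>"
proof -
  obtain h where h: "bij_betw h {0..<card I} I"
    using ex_bij_betw_nat_finite[OF assms] by blast
  have "(\<Sum>i\<in>I. (a i \<rhd> \<eta>) \<lhd> b i) = (\<Sum>j\<in>{0..<card I}. (a (h j) \<rhd> \<eta>) \<lhd> b (h j))"
    by (rule sum.reindex_bij_betw[OF h, symmetric])
  then show ?thesis unfolding AA_span_def
    by (intro CollectI exI[of _ "{0..<card I}"] exI[of _ "\<lambda>j. a (h j)"] exI[of _ "\<lambda>j. b (h j)"]) simp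
qed

lemma right_submodule_AA_span:
  assumes \<eta>: "\<eta> \<in> K"
  shows "right_submodule (AA_span lact ract \<eta>)"
  unfolding right_submodule_def
proof (intro conjI ballI allI)
  show "AA_span lact ract \<eta> \<subseteq> K"
    using \<eta> by (auto simp: AA_span_def intro!: sum_closed ract_closed lact_closed)
  show "0 \<in> AA_span lact ract \<eta>"
    using sum_in_AA_span[of "{}::nat set"] by simp
next
  fix x y assume "x \<in> AA_span lact ract \<eta>" "y \<in> AA_span lact ract \<eta>"
  then obtain I J :: "nat set" and a a' b b' where fin: "finite I" "finite J"
    and x: "x = (\<Sum>i\<in>I. (a i \<rhd> \<eta>) \<lhd> a' i)" and y: "y = (\<Sum>j\<in>J. (b j \<rhd> \<eta>) \<lhd> b' j)"
    by (auto simp: AA_span_def)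
  \<comment> \<open>The index sets may overlap, so the two sums are merged over their disjoint union.\<close>
  have "x + y = (\<Sum>k\<in>I <+> J. (case_sum a b k \<rhd> \<eta>) \<lhd> case_sum a' b' k)"
    using fin by (simp add: x y sum.Plus)
  then show "x + y \<in> AA_span lact ract \<eta>"
    using sum_in_AA_span[of "I <+> J"] fin by simp
next
  fix x c assume "x \<in> AA_span lact ract \<eta>"
  then obtain I :: "nat set" and a b where fin: "finite I"
    and x: "x = (\<Sum>i\<in>I. (a i \<rhd> \<eta>) \<lhd> b i)"
    by (auto simp: AA_span_def)
  have "x \<lhd> c = (\<Sum>i\<in>I. (a i \<rhd> \<eta>) \<lhd> (b i * c))"
    using \<eta> by (simp add: x ract_sum_left ract_mult ract_closed lact_closed)
  then show "x \<lhd> c \<in> AA_span lact ract \<eta>"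
    using sum_in_AA_span[OF fin] by simp
qed

lemma generator_in_AA_span:
  assumes "\<eta> \<in> K"
  shows "\<eta> \<in> AA_span lact ract \<eta>"
  using sum_in_AA_span[of "{()}" "\<lambda>_. 1" \<eta> "\<lambda>_. 1"] assms by (simp add: lact_one ract_one)

text \<open>The nearby vector in \<open>A \<rhd> \<zeta> \<lhd> A\<close> is obtained by using for \<open>\<zeta>\<close> the coefficients that express \<open>x\<close>
  through \<open>\<eta>\<close>; \<open>C\<close> is a Lipschitz constant of the resulting map in \<open>\<zeta>\<close>.\<close>

lemma AA_span_perturb_generator:
  assumes U: "right_pimsner_popa_basis K ract rinner U"
    and \<eta>: "\<eta> \<in> K" and x: "x \<in> AA_span lact ract \<eta>"
  obtains C where "C \<ge> 0"
    and "\<And>\<zeta>. \<zeta> \<in> K \<Longrightarrow> \<exists>v\<in>AA_span lact ract \<zeta>. norm (v - x) \<le> C * norm (\<zeta> - \<eta>)"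
proof -
  obtain I :: "nat set" and a b where fin: "finite I"
    and x: "x = (\<Sum>i\<in>I. (a i \<rhd> \<eta>) \<lhd> b i)"
    using x by (auto simp: AA_span_def)
  have "\<exists>D\<ge>0. \<forall>z\<in>K. norm (a i \<rhd> z) \<le> D * norm z" for i
    by (rule lact_bounded[OF U, of "a i"]) auto
  then obtain D where D: "\<And>i. D i \<ge> 0" "\<And>i z. z \<in> K \<Longrightarrow> norm (a i \<rhd> z) \<le> D i * norm z"
    by metis
  define C where "C = (\<Sum>i\<in>I. D i * norm (b i))"
  have "\<exists>v\<in>AA_span lact ract \<zeta>. norm (v - x) \<le> C * norm (\<zeta> - \<eta>)" if \<zeta>: "\<zeta> \<in> K" for \<zeta>
  proof
    let ?v = "\<Sum>i\<in>I. (a i \<rhd> \<zeta>) \<lhd> b i"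
    show "?v \<in> AA_span lact ract \<zeta>" by (rule sum_in_AA_span[OF fin])
    have "?v - x = (\<Sum>i\<in>I. (a i \<rhd> (\<zeta> - \<eta>)) \<lhd> b i)"
      using \<eta> \<zeta> by (simp add: x lact_diff_right ract_diff_left lact_closed sum_subtractf)
    also have "norm \<dots> \<le> (\<Sum>i\<in>I. D i * norm (\<zeta> - \<eta>) * norm (b i))"
    proof (rule sum_norm_le)
      fix i assume "i \<in> I"
      have d: "\<zeta> - \<eta> \<in> K" by (rule diff_closed[OF \<zeta> \<eta>])
      show "norm ((a i \<rhd> (\<zeta> - \<eta>)) \<lhd> b i) \<le> D i * norm (\<zeta> - \<eta>) * norm (b i)"
        using norm_ract_le[OF lact_closed[OF d], of "a i" "b i"]
          mult_right_mono[OF D(2)[OF d, of i], of "norm (b i)"] by simp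
    qed
    also have "\<dots> = C * norm (\<zeta> - \<eta>)"
      unfolding C_def sum_distrib_right by (simp add: mult_ac)
    finally show "norm (?v - x) \<le> C * norm (\<zeta> - \<eta>)" .
  qed
  moreover have "C \<ge> 0" using D(1) by (auto simp: C_def intro!: sum_nonneg)
  ultimately show thesis using that by blast
qed

lemma AA_span_eq_if_dense:
  assumes U: "right_pimsner_popa_basis K ract rinner U"
    and \<xi>: "\<xi> \<in> K" and dense: "K \<subseteq> closure (AA_span lact ract \<xi>)"
  shows "AA_span lact ract \<xi> = K"
proof -
  obtain \<delta> where \<delta>: "\<delta> > 0"
    and near: "\<And>N. right_submodule N \<Longrightarrow> \<forall>u\<in>U. \<exists>v\<in>N. norm (v - u) < \<delta> \<Longrightarrow> N = K"
    using right_submodule_near_basis[OF U] by blast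
  show ?thesis
  proof (rule near[OF right_submodule_AA_span[OF \<xi>]], rule ballI)
    fix u assume "u \<in> U"
    then have "u \<in> closure (AA_span lact ract \<xi>)"
      using U dense by (auto simp: right_pimsner_popa_basis_def)
    then show "\<exists>v\<in>AA_span lact ract \<xi>. norm (v - u) < \<delta>"
      using \<delta> by (auto simp: closure_approachable dist_norm)
  qed
qed

lemma openin_generators:
  assumes U: "right_pimsner_popa_basis K ract rinner U"
  shows "openin (top_of_set K) {\<eta> \<in> K. AA_span lact ract \<eta> = K}"
  unfolding openin_euclidean_subtopology_iff
proof (intro conjI ballI)
  fix \<eta> assume "\<eta> \<in> {\<eta> \<in> K. AA_span lact ract \<eta> = K}"
  then have \<eta>: "\<eta> \<in> K" and gen: "AA_span lact ract \<eta> = K" by auto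
  have fin: "finite U" and UK: "U \<subseteq> K" using U by (auto simp: right_pimsner_popa_basis_def)
  obtain \<delta> where \<delta>: "\<delta> > 0"
    and near: "\<And>N. right_submodule N \<Longrightarrow> \<forall>u\<in>U. \<exists>v\<in>N. norm (v - u) < \<delta> \<Longrightarrow> N = K"
    using right_submodule_near_basis[OF U] by blast
  have "\<exists>C\<ge>0. \<forall>\<zeta>\<in>K. \<exists>v\<in>AA_span lact ract \<zeta>. norm (v - u) \<le> C * norm (\<zeta> - \<eta>)" if "u \<in> U" for u
  proof -
    have "u \<in> AA_span lact ract \<eta>" using UK that gen by auto
    then show ?thesis by (rule AA_span_perturb_generator[OF U \<eta>]) auto
  qed
  then obtain C where C: "\<And>u. u \<in> U \<Longrightarrow> C u \<ge> 0"
    "\<And>u \<zeta>. u \<in> U \<Longrightarrow> \<zeta> \<in> K \<Longrightarrow>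
       \<exists>v\<in>AA_span lact ract \<zeta>. norm (v - u) \<le> C u * norm (\<zeta> - \<eta>)"
    by metis
  \<comment> \<open>One radius that works for every \<open>u\<close>, since each \<open>C u\<close> is at most the sum.\<close>
  define e where "e = \<delta> / (1 + sum C U)"
  have s: "sum C U \<ge> 0" using C(1) by (rule sum_nonneg)
  show "\<exists>e>0. \<forall>\<zeta>\<in>K. dist \<zeta> \<eta> < e \<longrightarrow> \<zeta> \<in> {\<eta> \<in> K. AA_span lact ract \<eta> = K}"
  proof (intro exI conjI ballI impI)
    show "e > 0" using \<delta> s by (simp add: e_def)
    fix \<zeta> assume \<zeta>: "\<zeta> \<in> K" and close: "dist \<zeta> \<eta> < e"
    have "AA_span lact ract \<zeta> = K"
    proof (rule near[OF right_submodule_AA_span[OF \<zeta>]], rule ballI)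
      fix u assume u: "u \<in> U"
      obtain v where v: "v \<in> AA_span lact ract \<zeta>" "norm (v - u) \<le> C u * norm (\<zeta> - \<eta>)"
        using C(2)[OF u \<zeta>] by blast
      have "C u \<le> sum C U" using fin u C(1) by (intro member_le_sum) auto
      then have "C u * norm (\<zeta> - \<eta>) \<le> sum C U * e"
        using close C(1)[OF u] s by (intro mult_mono) (auto simp: dist_norm)
      also have "\<dots> < \<delta>" using \<delta> s by (simp add: e_def field_simps)
      finally show "\<exists>v\<in>AA_span lact ract \<zeta>. norm (v - u) < \<delta>" using v by force
    qed
    with \<zeta> show "\<zeta> \<in> {\<eta> \<in> K. AA_span lact ract \<eta> = K}" by simp
  qed
qed auto

end

theorem theorem2p2:
  fixes M :: "'m::complex_normed_vector set"
    and lact :: "'a::unital_cstar_algebra \<Rightarrow> 'm \<Rightarrow> 'm"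
    and ract :: "'m \<Rightarrow> 'a \<Rightarrow> 'm"
    and rinner :: "'m \<Rightarrow> 'm \<Rightarrow> 'a"
    and \<xi> :: 'm
  defines "M\<xi> \<equiv> generated_sub lact ract \<xi>"
  assumes "right_correspondence M lact ract rinner"
    and "\<xi> \<in> M"
    and "Bim_fgp M\<xi> lact ract rinner"
  shows "\<xi> \<in> {\<eta> \<in> M\<xi>. AA_span lact ract \<eta> = M\<xi>} \<and>
         {\<eta> \<in> M\<xi>. AA_span lact ract \<eta> = M\<xi>} \<subseteq> M\<xi> \<and>
         openin (top_of_set M\<xi>) {\<eta> \<in> M\<xi>. AA_span lact ract \<eta> = M\<xi>} \<and>
         algebraically_generates lact ract \<xi> M\<xi>"
proof -
  interpret M: right_correspondence M lact ract rinner by fact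
  obtain U where U: "right_pimsner_popa_basis M\<xi> ract rinner U"
    using assms(4) by (auto simp: Bim_fgp_def)
  interpret K: right_correspondence M\<xi> lact ract rinner
    using assms(4) by (simp add: Bim_fgp_def)
  have M\<xi>: "M\<xi> = closure (AA_span lact ract \<xi>)"
    by (simp add: M\<xi>_def generated_sub_def)
  have \<xi>: "\<xi> \<in> M\<xi>"
    using M.generator_in_AA_span[OF \<open>\<xi> \<in> M\<close>] closure_subset by (auto simp: M\<xi>)
  have gen: "AA_span lact ract \<xi> = M\<xi>"
    by (rule K.AA_span_eq_if_dense[OF U \<xi>]) (simp add: M\<xi>)
  show ?thesis
    using \<xi> gen K.openin_generators[OF U] by (auto simp: algebraically_generates_def)
qed

end
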